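(* Let $r$ be a positive integer, let $G_1, \ldots, G_r$ be pairwise non-isomorphic connected graphs, and let $N$ be a positive integer such that $P_{\ell}^u (G_j, k) = P^u (G_j, k)$ for each $j \in \{1, \ldots, r\}$ and all integers $k \geq N$. Then, for any positive integers $m_1, \ldots, m_r$, the graph $G = \sum_{j = 1}^r m_j G_j$ satisfies $P_{\ell}^u (G, k) = P^u (G, k)$ for all integers $k \geq N$ (with the same $N$).
   Context: All graphs are nonempty, finite and simple. For a graph $H$ and a positive integer $m$, $mH$ denotes the disjoint union of $m$ copies of $H$. For vertex-disjoint graphs $H_1, \ldots, H_r$, $\sum_{j=1}^r H_j$ denotes their disjoint union. A proper $k$-coloring of a graph $G$ is a map $f : V(G) \to \{1, \ldots, k\}$ such that adjacent vertices receive different values. Two colorings $f, g$ of $G$ are equivalent up to labeling if there is an automorphism $\pi$ of $G$ such that $f(v) = g(\pi(v))$ for all $v \in V(G)$. $P^u(G,k)$ denotes the number of equivalence classes of proper $k$-colorings of $G$ under this relation. A $k$-assignment $L$ for $G$ assigns to each vertex $v \in V(G)$ a set $L(v)$ of exactly $k$ available colors (there is no restriction on which colors are used, and different vertices may have different lists). A proper $L$-coloring of $G$ is a map $f$ on $V(G)$ with $f(v) \in L(v)$ for every $v \in V(G)$ and $f(u) \ne f(v)$ whenever $u, v$ are adjacent. $P^u(G, L)$ denotes the number of equivalence classes of proper $L$-colorings of $G$, where two proper $L$-colorings $f, g$ are equivalent if $f = g \circ \pi$ for some automorphism $\pi$ of $G$. The unlabeled list color function $P^u_{\ell}(G, k)$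 is the minimum of $P^u(G, L)$ over all $k$-assignments $L$ for $G$. *)

theory Defs
  imports "HOL-Library.FuncSet" "Graph_Theory.Graph_Theory"
begin

text \<open>
  A finite simple graph is a \<open>pair_graph\<close>: a finite vertex set \<open>pverts G\<close> together with a
  symmetric and irreflexive adjacency relation \<open>parcs G\<close> on it. The predicate \<open>connected\<close>
  includes that the vertex set is nonempty.
\<close>

definition graph_isomorphism ::
  "('a \<Rightarrow> 'b) \<Rightarrow> 'a pair_pre_digraph \<Rightarrow> 'b pair_pre_digraph \<Rightarrow> bool" where
  "graph_isomorphism \<phi> G H \<longleftrightarrow>
     bij_betw \<phi> (pverts G) (pverts H) \<and>
     (\<forall>u\<in>pverts G. \<forall>v\<in>pverts G. (u, v) \<in> parcs G \<longleftrightarrow> (\<phi> u, \<phi> v) \<in> parcs H)"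

text \<open>
  The isomorphisms above are the vertex parts of the library's digraph isomorphisms.
\<close>

lemma digraph_iso_iff_graph_isomorphism:
  assumes "pair_wf_digraph G" "pair_wf_digraph H"
  shows "digraph_iso (with_proj G) (with_proj H) \<longleftrightarrow> (\<exists>\<phi>. graph_isomorphism \<phi> G H)"
proof
  interpret G: pair_wf_digraph G by fact
  interpret H: pair_wf_digraph H by fact
  {
    assume "digraph_iso (with_proj G) (with_proj H)"
    then obtain h where h: "pre_digraph.digraph_isomorphism (with_proj G) h"
      and H: "with_proj H = app_iso h (with_proj G)"
      by (auto simp: digraph_iso_def)
    from H have V: "pverts H = iso_verts h ` pverts G"
      and A: "parcs H = iso_arcs h ` parcs G"
      and t: "iso_tail h = fst" and d: "iso_head h = snd"
      by (auto simp: with_proj_def app_iso_def)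
    from h have inj: "inj_on (iso_verts h) (pverts G)"
      and arc: "\<And>a. a \<in> parcs G \<Longrightarrow> iso_arcs h a = (iso_verts h (fst a), iso_verts h (snd a))"
      by (auto simp: pre_digraph.digraph_isomorphism_def t d prod_eq_iff)
    have "(u, v) \<in> parcs G \<longleftrightarrow> (iso_verts h u, iso_verts h v) \<in> parcs H"
      if u: "u \<in> pverts G" and v: "v \<in> pverts G" for u v
    proof
      assume "(u, v) \<in> parcs G"
      then show "(iso_verts h u, iso_verts h v) \<in> parcs H"
        using arc[of "(u, v)"] by (auto simp: A intro: rev_image_eqI)
    next
      assume "(iso_verts h u, iso_verts h v) \<in> parcs H"
      then obtain x y where xy: "(x, y) \<in> parcs G"
        and eq: "(iso_verts h u, iso_verts h v) = iso_arcs h (x, y)"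
        by (auto simp: A)
      then have "iso_verts h u = iso_verts h x" "iso_verts h v = iso_verts h y"
        using arc[OF xy] by auto
      then have "u = x" "v = y"
        using inj_onD[OF inj] u v G.in_arcsD1[OF xy] G.in_arcsD2[OF xy] by blast+
      with xy show "(u, v) \<in> parcs G" by simp
    qed
    then have "graph_isomorphism (iso_verts h) G H"
      using V inj by (auto simp: graph_isomorphism_def bij_betw_def)
    then show "\<exists>\<phi>. graph_isomorphism \<phi> G H" by blast
  }
  {
    assume "\<exists>\<phi>. graph_isomorphism \<phi> G H"
    then obtain \<phi> where inj: "inj_on \<phi> (pverts G)" and V: "\<phi> ` pverts G = pverts H"
      and adj: "\<And>u v. u \<in> pverts G \<Longrightarrow> v \<in> pverts G \<Longrightarrow>
        (u, v) \<in> parcs G \<longleftrightarrow> (\<phi> u, \<phi> v) \<in> parcs H"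
      by (auto simp: graph_isomorphism_def bij_betw_def)
    define h where "h = \<lparr>iso_verts = \<phi>, iso_arcs = map_prod \<phi> \<phi>, iso_head = snd, iso_tail = fst\<rparr>"
    have wf: "wf_digraph (with_proj G)"
      by (rule G.wf_digraph_axioms)
    have injp: "inj_on (map_prod \<phi> \<phi>) (parcs G)"
      using G.in_arcsD1 G.in_arcsD2 inj_onD[OF inj] by (auto simp: inj_on_def)
    have "pre_digraph.digraph_isomorphism (with_proj G) h"
      using wf inj injp by (auto simp: pre_digraph.digraph_isomorphism_def h_def)
    moreover have "parcs H = map_prod \<phi> \<phi> ` parcs G"
    proof (intro set_eqI iffI)
      fix e assume e: "e \<in> parcs H"
      obtain a b where ab: "e = (a, b)" by (cases e)
      then obtain u v where "u \<in> pverts G" "v \<in> pverts G" "a = \<phi> u" "b = \<phi> v"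
        using e H.in_arcsD1 H.in_arcsD2 V by (metis imageE)
      moreover from this have "(u, v) \<in> parcs G"
        using adj[of u v] e ab by simp
      ultimately show "e \<in> map_prod \<phi> \<phi> ` parcs G"
        using ab by (auto intro: rev_image_eqI)
    next
      fix e assume "e \<in> map_prod \<phi> \<phi> ` parcs G"
      then obtain u v where "(u, v) \<in> parcs G" "e = (\<phi> u, \<phi> v)"
        by auto
      then show "e \<in> parcs H"
        using adj[of u v] G.in_arcsD1 G.in_arcsD2 by blast
    qed
    then have "with_proj H = app_iso h (with_proj G)"
      using V by (simp add: with_proj_def app_iso_def h_def)
    ultimately show "digraph_iso (with_proj G) (with_proj H)"
      by (auto simp: digraph_iso_def)
  }
qed

abbreviation graph_automorphism :: "('a \<Rightarrow> 'a) \<Rightarrow> 'a pair_pre_digraph \<Rightarrow> bool" where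
  "graph_automorphism \<pi> G \<equiv> graph_isomorphism \<pi> G G"

definition disjoint_union ::
  "'i set \<Rightarrow> ('i \<Rightarrow> 'a pair_pre_digraph) \<Rightarrow> ('i \<times> 'a) pair_pre_digraph" where
  "disjoint_union I H =
     \<lparr>pverts = (SIGMA i:I. pverts (H i)),
      parcs = {((i, u), (i, v)) |i u v. i \<in> I \<and> (u, v) \<in> parcs (H i)}\<rparr>"

definition copies :: "nat \<Rightarrow> 'a pair_pre_digraph \<Rightarrow> (nat \<times> 'a) pair_pre_digraph" where
  "copies m H = disjoint_union {1..m} (\<lambda>_. H)"

text \<open>
  Colors are natural numbers. Colorings are maps on the vertex set, hence extensional functions.
\<close>

definition proper_list_colorings :: "'a pair_pre_digraph \<Rightarrow> ('a \<Rightarrow> nat set) \<Rightarrow> ('a \<Rightarrow> nat) set" where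
  "proper_list_colorings G L =
     {f \<in> Pi\<^sub>E (pverts G) L. \<forall>(u, v)\<in>parcs G. f u \<noteq> f v}"

definition proper_colorings :: "'a pair_pre_digraph \<Rightarrow> nat \<Rightarrow> ('a \<Rightarrow> nat) set" where
  "proper_colorings G k =
     {f \<in> pverts G \<rightarrow>\<^sub>E {1..k}. \<forall>(u, v)\<in>parcs G. f u \<noteq> f v}"

definition coloring_equiv ::
  "'a pair_pre_digraph \<Rightarrow> ('a \<Rightarrow> nat) set \<Rightarrow> (('a \<Rightarrow> nat) \<times> ('a \<Rightarrow> nat)) set" where
  "coloring_equiv G C =
     {(f, g). f \<in> C \<and> g \<in> C \<and> (\<exists>\<pi>. graph_automorphism \<pi> G \<and> (\<forall>v\<in>pverts G. f v = g (\<pi> v)))}"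

lemma equiv_coloring_equiv: "equiv C (coloring_equiv G C)"
proof (rule equivI)
  show "coloring_equiv G C \<subseteq> C \<times> C"
    by (auto simp: coloring_equiv_def)
  have "graph_automorphism id G"
    by (simp add: graph_isomorphism_def)
  then show "refl_on C (coloring_equiv G C)"
    by (auto simp: coloring_equiv_def refl_on_def intro!: exI[of _ id])
  show "sym (coloring_equiv G C)"
  proof (rule symI)
    fix f g assume "(f, g) \<in> coloring_equiv G C"
    then obtain \<pi> where fg: "f \<in> C" "g \<in> C" and \<pi>: "graph_automorphism \<pi> G"
      and eq: "\<And>v. v \<in> pverts G \<Longrightarrow> f v = g (\<pi> v)"
      by (auto simp: coloring_equiv_def)
    let ?\<rho> = "inv_into (pverts G) \<pi>"
    have b: "bij_betw \<pi> (pverts G) (pverts G)"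
      using \<pi> by (simp add: graph_isomorphism_def)
    have \<rho>: "bij_betw ?\<rho> (pverts G) (pverts G)"
      using b by (rule bij_betw_inv_into)
    have inv: "\<pi> (?\<rho> v) = v" "?\<rho> v \<in> pverts G" if "v \<in> pverts G" for v
      using that b \<rho> by (auto simp: bij_betw_inv_into_right bij_betw_apply)
    have "(u, v) \<in> parcs G \<longleftrightarrow> (?\<rho> u, ?\<rho> v) \<in> parcs G"
      if u: "u \<in> pverts G" and v: "v \<in> pverts G" for u v
    proof -
      have "(?\<rho> u, ?\<rho> v) \<in> parcs G \<longleftrightarrow> (\<pi> (?\<rho> u), \<pi> (?\<rho> v)) \<in> parcs G"
        using \<pi> inv(2)[OF u] inv(2)[OF v] unfolding graph_isomorphism_def by blast
      then show ?thesis
        by (simp only: inv(1)[OF u] inv(1)[OF v])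
    qed
    with \<rho> have "graph_automorphism ?\<rho> G"
      unfolding graph_isomorphism_def by blast
    moreover have "g v = f (?\<rho> v)" if "v \<in> pverts G" for v
      using eq[OF inv(2)[OF that]] inv(1)[OF that] by simp
    ultimately show "(g, f) \<in> coloring_equiv G C"
      using fg by (auto simp: coloring_equiv_def)
  qed
  show "trans (coloring_equiv G C)"
  proof (rule transI)
    fix f g h assume "(f, g) \<in> coloring_equiv G C" "(g, h) \<in> coloring_equiv G C"
    then obtain \<pi> \<rho> where fh: "f \<in> C" "h \<in> C"
      and \<pi>: "graph_automorphism \<pi> G" and \<rho>: "graph_automorphism \<rho> G"
      and eq: "\<And>v. v \<in> pverts G \<Longrightarrow> f v = g (\<pi> v)" "\<And>v. v \<in> pverts G \<Longrightarrow> g v = h (\<rho> v)"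
      by (auto simp: coloring_equiv_def)
    have V: "\<pi> v \<in> pverts G" if "v \<in> pverts G" for v
      using \<pi> that by (auto simp: graph_isomorphism_def bij_betw_apply)
    have "bij_betw (\<rho> \<circ> \<pi>) (pverts G) (pverts G)"
      using \<pi> \<rho> by (auto simp: graph_isomorphism_def intro: bij_betw_trans)
    moreover have "(u, v) \<in> parcs G \<longleftrightarrow> ((\<rho> \<circ> \<pi>) u, (\<rho> \<circ> \<pi>) v) \<in> parcs G"
      if u: "u \<in> pverts G" and v: "v \<in> pverts G" for u v
    proof -
      have "(u, v) \<in> parcs G \<longleftrightarrow> (\<pi> u, \<pi> v) \<in> parcs G"
        using \<pi> u v unfolding graph_isomorphism_def by blast
      also have "\<dots> \<longleftrightarrow> (\<rho> (\<pi> u), \<rho> (\<pi> v)) \<in> parcs G"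
        using \<rho> V[OF u] V[OF v] unfolding graph_isomorphism_def by blast
      finally show ?thesis by simp
    qed
    ultimately have "graph_automorphism (\<rho> \<circ> \<pi>) G"
      unfolding graph_isomorphism_def by blast
    then show "(f, h) \<in> coloring_equiv G C"
      using fh eq V by (auto simp: coloring_equiv_def intro!: exI[of _ "\<rho> \<circ> \<pi>"])
  qed
qed

definition num_unlabeled_colorings :: "'a pair_pre_digraph \<Rightarrow> nat \<Rightarrow> nat" where
  "num_unlabeled_colorings G k =
     card (proper_colorings G k // coloring_equiv G (proper_colorings G k))"

definition num_unlabeled_list_colorings :: "'a pair_pre_digraph \<Rightarrow> ('a \<Rightarrow> nat set) \<Rightarrow> nat" where
  "num_unlabeled_list_colorings G L =
     card (proper_list_colorings G L // coloring_equiv G (proper_list_colorings G L))"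

definition k_assignment :: "'a pair_pre_digraph \<Rightarrow> nat \<Rightarrow> ('a \<Rightarrow> nat set) \<Rightarrow> bool" where
  "k_assignment G k L \<longleftrightarrow> (\<forall>v\<in>pverts G. finite (L v) \<and> card (L v) = k)"

text \<open>
  The infimum in \<open>nat\<close> of a nonempty set is its minimum; that it is attained is recorded below.
\<close>

definition unlabeled_list_color_function :: "'a pair_pre_digraph \<Rightarrow> nat \<Rightarrow> nat" where
  "unlabeled_list_color_function G k =
     (INF L\<in>{L. k_assignment G k L}. num_unlabeled_list_colorings G L)"

lemma unlabeled_list_color_function_attained:
  "\<exists>L. k_assignment G k L \<and>
     unlabeled_list_color_function G k = num_unlabeled_list_colorings G L"
proof -
  have "k_assignment G k (\<lambda>_. {1..k})"
    by (simp add: k_assignment_def)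
  then have "num_unlabeled_list_colorings G ` {L. k_assignment G k L} \<noteq> {}"
    by auto
  from Inf_nat_def1[OF this] show ?thesis
    unfolding unlabeled_list_color_function_def by auto
qed

lemma unlabeled_list_color_function_le:
  "k_assignment G k L \<Longrightarrow>
     unlabeled_list_color_function G k \<le> num_unlabeled_list_colorings G L"
  unfolding unlabeled_list_color_function_def by (rule cINF_lower) auto

end

theory Submission
  imports Defs "HOL-Combinatorics.Permutations"
begin

text \<open>
  A coloring of the union of \<open>m j\<close> copies of each \<open>G j\<close> is a family of colorings \<open>f j i\<close> of \<open>G j\<close>,
  one for each copy \<open>i\<close>. An automorphism of the union permutes the components, since these are
  connected, and it only exchanges copies of the same \<open>G j\<close>, since the \<open>G j\<close> are pairwise
  non-isomorphic. Hence the automorphism class of the coloring amounts to one multiset for every \<open>j\<close>: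
  that of the automorphism classes of \<open>f j 1\<close>, ..., \<open>f j (m j)\<close>
  (\<open>equivalent_iff_same_component_classes\<close>).

  Let \<open>A j i\<close> be the set of classes that contain a coloring of the \<open>i\<close>-th copy of \<open>G j\<close> from its lists.
  Colors on different components are chosen independently, so the classes of list colorings of the
  union correspond to the families \<open>M\<close> in which \<open>M j\<close> is a multiset with one element from each of
  \<open>A j 1\<close>, ..., \<open>A j (m j)\<close> (\<open>num_unlabeled_list_colorings_union\<close>). For ordinary \<open>k\<close>-colorings, the
  sets \<open>A j i\<close> are the same set \<open>B j\<close> for all \<open>i\<close>. The hypothesis says that \<open>B j\<close> has at most as many
  elements as \<open>A j i\<close> does for any lists of size \<open>k\<close>. So it remains to see that the number of multisets
  with one element from each of \<open>m\<close> given sets with at least \<open>b\<close> elements is smallest when these sets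
  coincide and have size \<open>b\<close>. This is \<open>card_transversals_const_le\<close>; its proof follows the recursion
  for the number of multisets.
\<close>

section \<open>Multisets with one element from each member of a family of sets\<close>

definition transversals :: "'i set \<Rightarrow> ('i \<Rightarrow> 'b set) \<Rightarrow> 'b multiset set" where
  "transversals J A = (\<lambda>s. image_mset s (mset_set J)) ` Pi\<^sub>E J A"

lemma image_mset_in_transversals:
  assumes "\<And>i. i \<in> J \<Longrightarrow> s i \<in> A i"
  shows "image_mset s (mset_set J) \<in> transversals J A"
proof -
  have "image_mset s (mset_set J) = image_mset (restrict s J) (mset_set J)"
    by (cases "finite J") (auto intro!: image_mset_cong)
  then show ?thesis
    using assms unfolding transversals_def by (intro image_eqI[of _ _ "restrict s J"]) auto
qed

lemma finite_transversals:
  assumes "finite J" "\<And>i. i \<in> J \<Longrightarrow> finite (A i)"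
  shows "finite (transversals J A)"
  using assms by (simp add: transversals_def finite_PiE)

text \<open>
  Fix \<open>x \<in> A j\<close>. The transversals include the multisets \<open>add_mset x M\<close> with \<open>M\<close> a transversal of the
  family without \<open>A j\<close>, and the transversals of the family \<open>A i - {x}\<close>; the first ones contain \<open>x\<close> and
  the others do not. For multisets over \<open>B\<close> the corresponding split, by whether they contain some
  \<open>b \<in> B\<close>, is exhaustive. So the inequality follows by induction on the sum of the sizes of \<open>J\<close> and \<open>B\<close>.
  Finiteness is carried along because the same split provides it.
\<close>

lemma card_multisets_le_card_transversals:
  assumes "finite J" "finite B" "\<And>i. i \<in> J \<Longrightarrow> finite (A i) \<and> card B \<le> card (A i)"
  shows "finite {M. set_mset M \<subseteq> B \<and> size M = card J} \<and>
    card {M. set_mset M \<subseteq> B \<and> size M = card J} \<le> card (transversals J A)"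
  using assms
proof (induction "card J + card B" arbitrary: J B A rule: less_induct)
  case less
  show ?case
  proof (cases "J = {}")
    case True
    have "{M. set_mset M \<subseteq> B \<and> size M = card J} = {{#}}"
      using True by auto
    moreover have "transversals J A = {{#}}"
      using True by (simp add: transversals_def)
    ultimately show ?thesis by simp
  next
    case False
    then obtain j where j: "j \<in> J" by blast
    have cJ: "card J = Suc (card (J - {j}))"
      using card.remove[OF less.prems(1) j] .
    show ?thesis
    proof (cases "B = {}")
      case True
      have none: "{M. set_mset M \<subseteq> B \<and> size M = card J} = {}"
        using True cJ by auto
      show ?thesis unfolding none by simp
    next
      case False
      then obtain b where b: "b \<in> B" by blast
      have cB: "card B = Suc (card (B - {b}))"
        using card.remove[OF less.prems(2) b] .
      obtain x where x: "x \<in> A j"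
        using less.prems(3)[OF j] cB by fastforce
      let ?S1 = "{M. set_mset M \<subseteq> B \<and> size M = card (J - {j})}"
      let ?S2 = "{M. set_mset M \<subseteq> B - {b} \<and> size M = card J}"
      let ?T1 = "transversals (J - {j}) A"
      let ?T2 = "transversals J (\<lambda>i. A i - {x})"
      have 1: "finite ?S1 \<and> card ?S1 \<le> card ?T1"
        by (rule less.hyps) (use less.prems cJ in auto)
      have 2: "finite ?S2 \<and> card ?S2 \<le> card ?T2"
      proof (rule less.hyps)
        show "finite (A i - {x}) \<and> card (B - {b}) \<le> card (A i - {x})" if "i \<in> J" for i
          using less.prems(3)[OF that] cB by (cases "x \<in> A i") (auto simp: card_Diff_singleton)
      qed (use less.prems cB in auto)
      have S: "{M. set_mset M \<subseteq> B \<and> size M = card J} = add_mset b ` ?S1 \<union> ?S2"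
      proof (intro set_eqI iffI)
        fix M assume M: "M \<in> {M. set_mset M \<subseteq> B \<and> size M = card J}"
        show "M \<in> add_mset b ` ?S1 \<union> ?S2"
        proof (cases "b \<in># M")
          case True
          then obtain M' where "M = add_mset b M'"
            by (metis multi_member_split)
          then show ?thesis using M cJ by auto
        qed (use M in auto)
      next
        fix M assume "M \<in> add_mset b ` ?S1 \<union> ?S2"
        then show "M \<in> {M. set_mset M \<subseteq> B \<and> size M = card J}"
          using b cJ by auto
      qed
      have T1: "add_mset x ` ?T1 \<subseteq> transversals J A"
      proof clarify
        fix M assume "M \<in> ?T1"
        then obtain s where s: "s \<in> Pi\<^sub>E (J - {j}) A" and M: "M = image_mset s (mset_set (J - {j}))"
          by (auto simp: transversals_def)
        have "mset_set J = add_mset j (mset_set (J - {j}))"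
          using j less.prems(1) by (rule mset_set.remove[rotated])
        moreover have "image_mset (s(j := x)) (mset_set (J - {j})) = M"
          using less.prems(1) unfolding M by (auto intro!: image_mset_cong)
        ultimately have "add_mset x M = image_mset (s(j := x)) (mset_set J)"
          by simp
        moreover have "image_mset (s(j := x)) (mset_set J) \<in> transversals J A"
          by (rule image_mset_in_transversals) (use s x in auto)
        ultimately show "add_mset x M \<in> transversals J A"
          by simp
      qed
      have T2: "?T2 \<subseteq> transversals J A"
        unfolding transversals_def by (intro image_mono PiE_mono) auto
      have "x \<notin># M" if "M \<in> ?T2" for M
        using that less.prems(1) by (auto simp: transversals_def)
      then have disj: "add_mset x ` ?T1 \<inter> ?T2 = {}"
        by fastforce
      have fin: "finite (transversals J A)"
        using less.prems by (intro finite_transversals) auto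
      have "card {M. set_mset M \<subseteq> B \<and> size M = card J} \<le> card (add_mset b ` ?S1) + card ?S2"
        unfolding S by (rule card_Un_le)
      also have "\<dots> \<le> card (add_mset x ` ?T1) + card ?T2"
        using 1 2 by (simp add: card_image inj_on_def add_mono)
      also have "\<dots> = card (add_mset x ` ?T1 \<union> ?T2)"
        using T1 T2 fin disj by (intro card_Un_disjoint[symmetric]) (auto dest: finite_subset)
      also have "\<dots> \<le> card (transversals J A)"
        using T1 T2 fin by (intro card_mono) auto
      finally show ?thesis
        using 1 2 S by simp
    qed
  qed
qed

lemma card_transversals_const_le:
  assumes "finite J" "finite B" "\<And>i. i \<in> J \<Longrightarrow> finite (A i) \<and> card B \<le> card (A i)"
  shows "card (transversals J (\<lambda>_. B)) \<le> card (transversals J A)"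
proof -
  have "transversals J (\<lambda>_. B) \<subseteq> {M. set_mset M \<subseteq> B \<and> size M = card J}"
    using assms(1) by (auto simp: transversals_def)
  then have "card (transversals J (\<lambda>_. B)) \<le> card {M. set_mset M \<subseteq> B \<and> size M = card J}"
    using card_multisets_le_card_transversals[of J B A] assms by (intro card_mono) auto
  also have "\<dots> \<le> card (transversals J A)"
    using card_multisets_le_card_transversals[of J B A] assms by blast
  finally show ?thesis .
qed

section \<open>Automorphism classes of colorings\<close>

text \<open>
  The class is taken among all maps on the vertex set. Classes of colorings from different list
  assignments can then be compared, which is impossible for the elements of the quotients that
  define the unlabeled counts.
\<close>

definition coloring_class :: "'a pair_pre_digraph \<Rightarrow> ('a \<Rightarrow> nat) \<Rightarrow> ('a \<Rightarrow> nat) set" where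
  "coloring_class H f = coloring_equiv H (extensional (pverts H)) `` {f}"

lemma coloring_class_eq_iff:
  assumes "f \<in> extensional (pverts H)" "g \<in> extensional (pverts H)"
  shows "coloring_class H f = coloring_class H g \<longleftrightarrow>
    (\<exists>\<pi>. graph_automorphism \<pi> H \<and> (\<forall>v\<in>pverts H. f v = g (\<pi> v)))"
  using assms eq_equiv_class_iff[OF equiv_coloring_equiv, of f "extensional (pverts H)" g H]
  by (auto simp: coloring_class_def coloring_equiv_def)

lemma card_image_eq_card_image:
  assumes "\<And>x y. x \<in> C \<Longrightarrow> y \<in> C \<Longrightarrow> F x = F y \<longleftrightarrow> G x = G y"
  shows "card (F ` C) = card (G ` C)"
proof -
  have "bij_betw (G \<circ> inv_into C F) (F ` C) (G ` C)"
  proof (rule bij_betwI')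
    fix a b assume "a \<in> F ` C" "b \<in> F ` C"
    then show "(G \<circ> inv_into C F) a = (G \<circ> inv_into C F) b \<longleftrightarrow> a = b"
      using assms by (metis comp_apply f_inv_into_f inv_into_into)
  next
    fix a assume "a \<in> F ` C"
    then show "(G \<circ> inv_into C F) a \<in> G ` C"
      by (simp add: inv_into_into)
  next
    fix c assume "c \<in> G ` C"
    then obtain x where x: "x \<in> C" "c = G x" by blast
    then have "c = (G \<circ> inv_into C F) (F x)"
      using assms by (metis comp_apply f_inv_into_f imageI inv_into_into)
    with x show "\<exists>a\<in>F ` C. c = (G \<circ> inv_into C F) a" by blast
  qed
  then show ?thesis by (rule bij_betw_same_card)
qed

text \<open>
  Any complete invariant of colorings up to automorphism counts the equivalence classes.
\<close>

lemma num_unlabeled_list_colorings_eq_card_image: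
  assumes "\<And>f g. f \<in> proper_list_colorings H L \<Longrightarrow> g \<in> proper_list_colorings H L \<Longrightarrow>
    F f = F g \<longleftrightarrow> (\<exists>\<pi>. graph_automorphism \<pi> H \<and> (\<forall>v\<in>pverts H. f v = g (\<pi> v)))"
  shows "num_unlabeled_list_colorings H L = card (F ` proper_list_colorings H L)"
proof -
  let ?C = "proper_list_colorings H L"
  let ?R = "coloring_equiv H ?C"
  have quotient: "?C // ?R = (\<lambda>f. ?R `` {f}) ` ?C"
    by (auto simp: quotient_def)
  have "?R `` {f} = ?R `` {g} \<longleftrightarrow> F f = F g" if "f \<in> ?C" "g \<in> ?C" for f g
    using that assms[OF that] eq_equiv_class_iff[OF equiv_coloring_equiv, of f ?C g H]
    by (auto simp: coloring_equiv_def)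
  then show ?thesis
    unfolding num_unlabeled_list_colorings_def quotient by (rule card_image_eq_card_image)
qed

definition list_coloring_classes :: "'a pair_pre_digraph \<Rightarrow> ('a \<Rightarrow> nat set) \<Rightarrow> ('a \<Rightarrow> nat) set set" where
  "list_coloring_classes H L = coloring_class H ` proper_list_colorings H L"

lemma proper_list_colorings_extensional:
  "f \<in> proper_list_colorings H L \<Longrightarrow> f \<in> extensional (pverts H)"
  by (auto simp: proper_list_colorings_def PiE_def)

lemma card_list_coloring_classes:
  "card (list_coloring_classes H L) = num_unlabeled_list_colorings H L"
  unfolding list_coloring_classes_def
  by (rule num_unlabeled_list_colorings_eq_card_image[symmetric])
    (simp add: coloring_class_eq_iff proper_list_colorings_extensional)

lemma finite_list_coloring_classes:
  assumes "finite (pverts H)" "\<And>v. v \<in> pverts H \<Longrightarrow> finite (L v)"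
  shows "finite (list_coloring_classes H L)"
proof -
  have "proper_list_colorings H L \<subseteq> Pi\<^sub>E (pverts H) L"
    by (auto simp: proper_list_colorings_def)
  then have "finite (proper_list_colorings H L)"
    using finite_PiE[OF assms] by (rule finite_subset)
  then show ?thesis
    by (simp add: list_coloring_classes_def)
qed

lemma num_unlabeled_colorings_eq_list:
  "num_unlabeled_colorings H k = num_unlabeled_list_colorings H (\<lambda>_. {1..k})"
  by (simp add: num_unlabeled_colorings_def num_unlabeled_list_colorings_def
      proper_colorings_def proper_list_colorings_def)

section \<open>Automorphisms of a disjoint union of connected graphs\<close>

text \<open>
  With \<open>c\<close> sending a vertex to the component of its image, this shows that homomorphic images of
  connected graphs lie in one component.
\<close>

lemma connected_imp_constant:
  assumes "connected (with_proj H)"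
    and "\<And>u v. (u, v) \<in> parcs H \<Longrightarrow> c u = c v"
    and "u \<in> pverts H" "v \<in> pverts H"
  shows "c u = c v"
proof -
  have "(u, v) \<in> rtrancl_on (pverts H) ((arcs_ends (with_proj H))\<^sup>s)"
    using assms(1,3,4) by (auto simp: connected_conv)
  then show ?thesis
    by (induction rule: rtrancl_on_induct) (auto dest: assms(2) simp: symcl_def)
qed

lemma graph_isomorphism_inv_into:
  assumes "graph_isomorphism \<pi> G H"
  shows "graph_isomorphism (inv_into (pverts G) \<pi>) H G"
proof -
  let ?\<rho> = "inv_into (pverts G) \<pi>"
  have b: "bij_betw \<pi> (pverts G) (pverts H)"
    using assms by (simp add: graph_isomorphism_def)
  then have \<rho>: "bij_betw ?\<rho> (pverts H) (pverts G)"
    by (rule bij_betw_inv_into)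
  have inv: "?\<rho> w \<in> pverts G" "\<pi> (?\<rho> w) = w" if "w \<in> pverts H" for w
    using that b \<rho> by (auto simp: bij_betw_apply bij_betw_inv_into_right)
  have "(u, v) \<in> parcs H \<longleftrightarrow> (?\<rho> u, ?\<rho> v) \<in> parcs G" if "u \<in> pverts H" "v \<in> pverts H" for u v
    using assms inv[OF that(1)] inv[OF that(2)] unfolding graph_isomorphism_def by metis
  with \<rho> show ?thesis
    by (simp add: graph_isomorphism_def)
qed

locale union_of_copies =
  fixes I :: "'i set" and J :: "'i \<Rightarrow> 'c set" and H :: "'i \<Rightarrow> 'a pair_pre_digraph"
  assumes finite_I: "finite I"
    and finite_J: "\<And>j. j \<in> I \<Longrightarrow> finite (J j)"
    and graph: "\<And>j. j \<in> I \<Longrightarrow> pair_graph (H j)"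
    and conn: "\<And>j. j \<in> I \<Longrightarrow> connected (with_proj (H j))"
    and non_isomorphic: "\<And>i j \<phi>. i \<in> I \<Longrightarrow> j \<in> I \<Longrightarrow> graph_isomorphism \<phi> (H i) (H j) \<Longrightarrow> i = j"
begin

definition union :: "('i \<times> 'c \<times> 'a) pair_pre_digraph" where
  "union = disjoint_union I (\<lambda>j. disjoint_union (J j) (\<lambda>_. H j))"

lemma pverts_union [simp]:
  "(j, i, v) \<in> pverts union \<longleftrightarrow> j \<in> I \<and> i \<in> J j \<and> v \<in> pverts (H j)"
  by (auto simp: union_def disjoint_union_def)

lemma parcs_union [simp]:
  "((j, i, u), (j', i', v)) \<in> parcs union \<longleftrightarrow>
     j' = j \<and> i' = i \<and> j \<in> I \<and> i \<in> J j \<and> (u, v) \<in> parcs (H j)"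
  by (auto simp: union_def disjoint_union_def)

lemma in_pverts_of_arc:
  assumes "j \<in> I" "(u, v) \<in> parcs (H j)"
  shows "u \<in> pverts (H j)" "v \<in> pverts (H j)"
proof -
  interpret pair_graph "H j" using assms(1) by (rule graph)
  show "u \<in> pverts (H j)" "v \<in> pverts (H j)"
    using in_arcsD1[OF assms(2)] in_arcsD2[OF assms(2)] .
qed

lemma finite_pverts: "j \<in> I \<Longrightarrow> finite (pverts (H j))"
  using graph[of j] by (simp add: pair_graph_def pair_digraph_def pair_fin_digraph.pair_finite_verts)

fun component :: "'i \<times> 'c \<times> 'a \<Rightarrow> 'i \<times> 'c" where
  "component (j, i, v) = (j, i)"

lemma same_component_image:
  assumes \<pi>: "graph_automorphism \<pi> union"
    and x: "x \<in> pverts union" and y: "y \<in> pverts union" and eq: "component x = component y"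
  shows "component (\<pi> x) = component (\<pi> y)"
proof -
  obtain j i u v where xy: "x = (j, i, u)" "y = (j, i, v)"
    using eq by (cases x, cases y) auto
  have ji: "j \<in> I" "i \<in> J j" "u \<in> pverts (H j)" "v \<in> pverts (H j)"
    using x y xy by auto
  have "component (\<pi> (j, i, a)) = component (\<pi> (j, i, b))" if "(a, b) \<in> parcs (H j)" for a b
  proof -
    have "((j, i, a), (j, i, b)) \<in> parcs union" "(j, i, a) \<in> pverts union" "(j, i, b) \<in> pverts union"
      using ji in_pverts_of_arc[OF ji(1) that] that by simp_all
    then have "(\<pi> (j, i, a), \<pi> (j, i, b)) \<in> parcs union"
      using \<pi> unfolding graph_isomorphism_def by blast
    then show ?thesis
      by (cases "\<pi> (j, i, a)", cases "\<pi> (j, i, b)") auto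
  qed
  then show ?thesis
    unfolding xy by (rule connected_imp_constant[OF conn[OF ji(1)] _ ji(3,4)])
qed

lemma same_component_image_iff:
  assumes \<pi>: "graph_automorphism \<pi> union" and x: "x \<in> pverts union" and y: "y \<in> pverts union"
  shows "component (\<pi> x) = component (\<pi> y) \<longleftrightarrow> component x = component y"
proof
  let ?\<rho> = "inv_into (pverts union) \<pi>"
  have b: "bij_betw \<pi> (pverts union) (pverts union)"
    using \<pi> by (simp add: graph_isomorphism_def)
  assume "component (\<pi> x) = component (\<pi> y)"
  then have "component (?\<rho> (\<pi> x)) = component (?\<rho> (\<pi> y))"
    by (rule same_component_image[OF graph_isomorphism_inv_into[OF \<pi>]
          bij_betw_apply[OF b x] bij_betw_apply[OF b y]])
  then show "component x = component y"
    using b x y by (simp add: bij_betw_inv_into_left)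
qed (rule same_component_image[OF \<pi> x y])

text \<open>
  An automorphism and its inverse both map connected pieces into single components, so the image of
  a component is a full component, isomorphic to it and hence a copy of the same graph.
\<close>

lemma automorphism_union_cases:
  assumes \<pi>: "graph_automorphism \<pi> union"
  obtains \<sigma> \<phi> where "\<And>j. j \<in> I \<Longrightarrow> bij_betw (\<sigma> j) (J j) (J j)"
    and "\<And>j i. j \<in> I \<Longrightarrow> i \<in> J j \<Longrightarrow> graph_automorphism (\<phi> j i) (H j)"
    and "\<And>j i v. j \<in> I \<Longrightarrow> i \<in> J j \<Longrightarrow> v \<in> pverts (H j) \<Longrightarrow> \<pi> (j, i, v) = (j, \<sigma> j i, \<phi> j i v)"
proof -
  define base where "base j = (SOME v. v \<in> pverts (H j))" for j
  define \<sigma> where "\<sigma> j i = snd (component (\<pi> (j, i, base j)))" for j i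
  define \<phi> where "\<phi> j i v = snd (snd (\<pi> (j, i, v)))" for j i v
  have base: "base j \<in> pverts (H j)" if "j \<in> I" for j
  proof -
    have "pverts (H j) \<noteq> {}"
      using conn[OF that] by (simp add: connected_conv)
    then show ?thesis
      unfolding base_def by (simp add: some_in_eq)
  qed
  have bij: "bij_betw \<pi> (pverts union) (pverts union)"
    using \<pi> by (simp add: graph_isomorphism_def)
  have comp: "\<sigma> j i \<in> J j \<and> graph_automorphism (\<phi> j i) (H j) \<and>
      (\<forall>v\<in>pverts (H j). \<pi> (j, i, v) = (j, \<sigma> j i, \<phi> j i v))"
    if j: "j \<in> I" and i: "i \<in> J j" for j i
  proof -
    let ?b = "(j, i, base j)"
    obtain j' i' w where ji': "\<pi> ?b = (j', i', w)" by (cases "\<pi> ?b") auto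
    have "\<pi> ?b \<in> pverts union"
      using bij base[OF j] j i by (simp add: bij_betw_apply)
    then have j': "j' \<in> I" and i': "i' \<in> J j'"
      using ji' by auto
    have eq: "\<pi> (j, i, v) = (j', i', \<phi> j i v)" if "v \<in> pverts (H j)" for v
    proof -
      have "component (\<pi> (j, i, v)) = component (\<pi> ?b)"
        using same_component_image[OF \<pi>] base[OF j] j i that by simp
      then show ?thesis
        unfolding \<phi>_def ji' by (cases "\<pi> (j, i, v)") auto
    qed
    have "graph_isomorphism (\<phi> j i) (H j) (H j')"
      unfolding graph_isomorphism_def
    proof (intro conjI ballI bij_betwI')
      fix u v assume uv: "u \<in> pverts (H j)" "v \<in> pverts (H j)"
      show "\<phi> j i u = \<phi> j i v \<longleftrightarrow> u = v"
        using eq[OF uv(1)] eq[OF uv(2)] bij j i uv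
          inj_onD[of \<pi> "pverts union" "(j, i, u)" "(j, i, v)"]
        by (auto simp: bij_betw_def)
      have "(j, i, u) \<in> pverts union" "(j, i, v) \<in> pverts union"
        using j i uv by simp_all
      then have "((j, i, u), (j, i, v)) \<in> parcs union \<longleftrightarrow>
          (\<pi> (j, i, u), \<pi> (j, i, v)) \<in> parcs union"
        using \<pi> unfolding graph_isomorphism_def by blast
      then have "(u, v) \<in> parcs (H j) \<longleftrightarrow> (\<pi> (j, i, u), \<pi> (j, i, v)) \<in> parcs union"
        using j i by simp
      then show "(u, v) \<in> parcs (H j) \<longleftrightarrow> (\<phi> j i u, \<phi> j i v) \<in> parcs (H j')"
        using eq uv j' i' by simp
    next
      fix v assume v: "v \<in> pverts (H j)"
      then have "\<pi> (j, i, v) \<in> pverts union"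
        using bij j i by (simp add: bij_betw_apply)
      then show "\<phi> j i v \<in> pverts (H j')"
        using eq[OF v] by simp
    next
      fix w assume "w \<in> pverts (H j')"
      then have "(j', i', w) \<in> \<pi> ` pverts union"
        using bij j' i' by (simp add: bij_betw_def)
      then obtain x where x: "x \<in> pverts union" "\<pi> x = (j', i', w)"
        by (metis imageE)
      have "component (\<pi> x) = component (\<pi> ?b)"
        using x ji' by simp
      then have "component x = (j, i)"
        using same_component_image_iff[OF \<pi> x(1), of ?b] base[OF j] j i by simp
      then obtain v where v: "x = (j, i, v)"
        by (cases x) auto
      then have "v \<in> pverts (H j)" "w = \<phi> j i v"
        using x eq[of v] by auto
      then show "\<exists>v\<in>pverts (H j). w = \<phi> j i v" by blast
    qed
    moreover from this have "j = j'"
      using non_isomorphic j j' by blast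
    moreover have "\<sigma> j i = i'"
      by (simp add: \<sigma>_def ji')
    ultimately show ?thesis
      using eq i' by simp
  qed
  have "bij_betw (\<sigma> j) (J j) (J j)" if j: "j \<in> I" for j
  proof -
    have "inj_on (\<sigma> j) (J j)"
    proof (rule inj_onI)
      fix i i' assume i: "i \<in> J j" "i' \<in> J j" and eq: "\<sigma> j i = \<sigma> j i'"
      have "component (\<pi> (j, i, base j)) = component (\<pi> (j, i', base j))"
        using comp[OF j i(1)] comp[OF j i(2)] eq base[OF j] by simp
      then show "i = i'"
        using same_component_image_iff[OF \<pi>] i j base[OF j] by simp
    qed
    moreover have "\<sigma> j ` J j \<subseteq> J j"
      using comp[OF j] by blast
    ultimately show ?thesis
      using endo_inj_surj[OF finite_J[OF j]] by (auto simp: bij_betw_def)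
  qed
  then show ?thesis
    using that comp by blast
qed

lemma automorphism_unionI:
  assumes \<sigma>: "\<And>j. j \<in> I \<Longrightarrow> bij_betw (\<sigma> j) (J j) (J j)"
    and \<phi>: "\<And>j i. j \<in> I \<Longrightarrow> i \<in> J j \<Longrightarrow> graph_automorphism (\<phi> j i) (H j)"
  shows "graph_automorphism (\<lambda>(j, i, v). (j, \<sigma> j i, \<phi> j i v)) union"
    (is "graph_automorphism ?\<pi> union")
proof -
  have \<phi>_bij: "bij_betw (\<phi> j i) (pverts (H j)) (pverts (H j))"
    and \<phi>_adj: "\<And>u v. u \<in> pverts (H j) \<Longrightarrow> v \<in> pverts (H j) \<Longrightarrow>
      (\<phi> j i u, \<phi> j i v) \<in> parcs (H j) \<longleftrightarrow> (u, v) \<in> parcs (H j)"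
    if "j \<in> I" "i \<in> J j" for j i
    using \<phi>[OF that] by (auto simp: graph_isomorphism_def)
  have \<sigma>_eq: "\<sigma> j i = \<sigma> j i' \<longleftrightarrow> i = i'" if "j \<in> I" "i \<in> J j" "i' \<in> J j" for j i i'
    using \<sigma>[OF that(1)] that by (auto simp: bij_betw_def inj_on_eq_iff)
  have \<phi>_eq: "\<phi> j i u = \<phi> j i v \<longleftrightarrow> u = v"
    if "j \<in> I" "i \<in> J j" "u \<in> pverts (H j)" "v \<in> pverts (H j)" for j i u v
    using \<phi>_bij[OF that(1,2)] that(3,4) by (auto simp: bij_betw_def inj_on_eq_iff)
  have "bij_betw ?\<pi> (pverts union) (pverts union)"
  proof (rule bij_betwI')
    fix x y assume "x \<in> pverts union" "y \<in> pverts union"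
    then show "?\<pi> x = ?\<pi> y \<longleftrightarrow> x = y"
      by (cases x, cases y) (auto simp: \<phi>_eq \<sigma>_eq)
  next
    fix x assume "x \<in> pverts union"
    then show "?\<pi> x \<in> pverts union"
      by (cases x) (auto intro: bij_betw_apply[OF \<phi>_bij] bij_betw_apply[OF \<sigma>])
  next
    fix y assume y: "y \<in> pverts union"
    obtain j i' w where y_def: "y = (j, i', w)" by (cases y) auto
    obtain i where i: "i \<in> J j" "i' = \<sigma> j i"
      using y y_def \<sigma>[of j] unfolding bij_betw_def by auto
    obtain v where "v \<in> pverts (H j)" "w = \<phi> j i v"
      using y y_def \<phi>_bij[of j i] i unfolding bij_betw_def by auto
    then show "\<exists>x\<in>pverts union. y = ?\<pi> x"
      using y y_def i by (intro bexI[of _ "(j, i, v)"]) auto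
  qed
  moreover have "(x, y) \<in> parcs union \<longleftrightarrow> (?\<pi> x, ?\<pi> y) \<in> parcs union"
    if "x \<in> pverts union" "y \<in> pverts union" for x y
    using that by (cases x, cases y) (auto simp: \<phi>_adj \<sigma>_eq intro: bij_betw_apply[OF \<sigma>])
  ultimately show ?thesis
    by (simp add: graph_isomorphism_def)
qed

section \<open>Colorings of a disjoint union\<close>

definition part :: "('i \<times> 'c \<times> 'a \<Rightarrow> nat) \<Rightarrow> 'i \<Rightarrow> 'c \<Rightarrow> 'a \<Rightarrow> nat" where
  "part f j i = (\<lambda>v\<in>pverts (H j). f (j, i, v))"

definition component_classes :: "('i \<times> 'c \<times> 'a \<Rightarrow> nat) \<Rightarrow> 'i \<Rightarrow> ('a \<Rightarrow> nat) set multiset" where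
  "component_classes f = (\<lambda>j\<in>I. image_mset (\<lambda>i. coloring_class (H j) (part f j i)) (mset_set (J j)))"

lemma coloring_class_part_eq_iff:
  "coloring_class (H j) (part f j i) = coloring_class (H j) (part g j i') \<longleftrightarrow>
    (\<exists>\<phi>. graph_automorphism \<phi> (H j) \<and> (\<forall>v\<in>pverts (H j). f (j, i, v) = g (j, i', \<phi> v)))"
proof -
  have "part g j i' (\<phi> v) = g (j, i', \<phi> v)" if "graph_automorphism \<phi> (H j)" "v \<in> pverts (H j)" for \<phi> v
    using that by (auto simp: part_def graph_isomorphism_def bij_betw_apply)
  moreover have "part f j i v = f (j, i, v)" if "v \<in> pverts (H j)" for v
    using that by (simp add: part_def)
  moreover have "part f j i \<in> extensional (pverts (H j))" "part g j i' \<in> extensional (pverts (H j))"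
    by (simp_all add: part_def)
  ultimately show ?thesis
    by (simp add: coloring_class_eq_iff cong: conj_cong)
qed

text \<open>
  Equal multisets of classes provide a permutation of the copies of each $G_j$ that matches equal
  classes, and every match provides an automorphism of $G_j$; together they form an automorphism of
  the union. The other direction reads the same data off a given automorphism.
\<close>

lemma equivalent_iff_same_component_classes:
  "(\<exists>\<pi>. graph_automorphism \<pi> union \<and> (\<forall>x\<in>pverts union. f x = g (\<pi> x))) \<longleftrightarrow>
    component_classes f = component_classes g"
proof
  assume "\<exists>\<pi>. graph_automorphism \<pi> union \<and> (\<forall>x\<in>pverts union. f x = g (\<pi> x))"
  then obtain \<pi> where \<pi>: "graph_automorphism \<pi> union"
    and fg: "\<And>x. x \<in> pverts union \<Longrightarrow> f x = g (\<pi> x)" by blast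
  from \<pi> obtain \<sigma> \<phi> where \<sigma>: "\<And>j. j \<in> I \<Longrightarrow> bij_betw (\<sigma> j) (J j) (J j)"
    and \<phi>: "\<And>j i. j \<in> I \<Longrightarrow> i \<in> J j \<Longrightarrow> graph_automorphism (\<phi> j i) (H j)"
    and eq: "\<And>j i v. j \<in> I \<Longrightarrow> i \<in> J j \<Longrightarrow> v \<in> pverts (H j) \<Longrightarrow> \<pi> (j, i, v) = (j, \<sigma> j i, \<phi> j i v)"
    using automorphism_union_cases by metis
  show "component_classes f = component_classes g"
    unfolding component_classes_def
  proof (rule restrict_ext)
    fix j assume j: "j \<in> I"
    have "coloring_class (H j) (part f j i) = coloring_class (H j) (part g j (\<sigma> j i))"
      if "i \<in> J j" for i
      unfolding coloring_class_part_eq_iff using \<phi>[OF j that] fg eq[OF j that] j that by auto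
    then have "image_mset (\<lambda>i. coloring_class (H j) (part f j i)) (mset_set (J j)) =
        image_mset (\<lambda>i. coloring_class (H j) (part g j (\<sigma> j i))) (mset_set (J j))"
      using finite_J[OF j] by (intro image_mset_cong) auto
    also have "\<dots> = image_mset (\<lambda>i. coloring_class (H j) (part g j i)) (image_mset (\<sigma> j) (mset_set (J j)))"
      by (simp add: image_mset.compositionality comp_def)
    also have "image_mset (\<sigma> j) (mset_set (J j)) = mset_set (J j)"
      using \<sigma>[OF j] by (simp add: bij_betw_def image_mset_mset_set)
    finally show "image_mset (\<lambda>i. coloring_class (H j) (part f j i)) (mset_set (J j)) =
        image_mset (\<lambda>i. coloring_class (H j) (part g j i)) (mset_set (J j))" .
  qed
next
  assume eq: "component_classes f = component_classes g"
  have "\<exists>\<sigma>. bij_betw \<sigma> (J j) (J j) \<and>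
      (\<forall>i\<in>J j. coloring_class (H j) (part f j i) = coloring_class (H j) (part g j (\<sigma> i)))"
    if j: "j \<in> I" for j
  proof -
    have "image_mset (\<lambda>i. coloring_class (H j) (part f j i)) (mset_set (J j)) =
        image_mset (\<lambda>i. coloring_class (H j) (part g j i)) (mset_set (J j))"
      using fun_cong[OF eq, of j] j by (simp add: component_classes_def)
    from image_mset_eq_implies_permutes[OF finite_J[OF j] this]
    obtain p where "p permutes J j"
      and "\<forall>i\<in>J j. coloring_class (H j) (part f j i) = coloring_class (H j) (part g j (p i))"
      by blast
    then show ?thesis
      using permutes_imp_bij by blast
  qed
  then obtain \<sigma> where \<sigma>: "\<And>j. j \<in> I \<Longrightarrow> bij_betw (\<sigma> j) (J j) (J j)"
    and "\<And>j i. j \<in> I \<Longrightarrow> i \<in> J j \<Longrightarrow>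
      coloring_class (H j) (part f j i) = coloring_class (H j) (part g j (\<sigma> j i))"
    by metis
  then have "\<exists>\<phi>. graph_automorphism \<phi> (H j) \<and> (\<forall>v\<in>pverts (H j). f (j, i, v) = g (j, \<sigma> j i, \<phi> v))"
    if "j \<in> I" "i \<in> J j" for j i
    using that by (simp add: coloring_class_part_eq_iff)
  then obtain \<phi> where \<phi>: "\<And>j i. j \<in> I \<Longrightarrow> i \<in> J j \<Longrightarrow> graph_automorphism (\<phi> j i) (H j)"
    and fg: "\<And>j i v. j \<in> I \<Longrightarrow> i \<in> J j \<Longrightarrow> v \<in> pverts (H j) \<Longrightarrow> f (j, i, v) = g (j, \<sigma> j i, \<phi> j i v)"
    by metis
  have "graph_automorphism (\<lambda>(j, i, v). (j, \<sigma> j i, \<phi> j i v)) union"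
    using \<sigma> \<phi> by (rule automorphism_unionI)
  then show "\<exists>\<pi>. graph_automorphism \<pi> union \<and> (\<forall>x\<in>pverts union. f x = g (\<pi> x))"
    using fg by (intro exI[of _ "\<lambda>(j, i, v). (j, \<sigma> j i, \<phi> j i v)"]) auto
qed

lemma proper_list_colorings_union_iff:
  "f \<in> proper_list_colorings union L \<longleftrightarrow>
    f \<in> extensional (pverts union) \<and>
    (\<forall>j\<in>I. \<forall>i\<in>J j. part f j i \<in> proper_list_colorings (H j) (\<lambda>v. L (j, i, v)))"
  (is "?l \<longleftrightarrow> ?e \<and> ?r")
proof -
  have "f \<in> proper_list_colorings union L \<longleftrightarrow> f \<in> extensional (pverts union) \<and>
      (\<forall>x\<in>pverts union. f x \<in> L x) \<and> (\<forall>(x, y)\<in>parcs union. f x \<noteq> f y)"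
    by (auto simp: proper_list_colorings_def PiE_iff)
  moreover have "(\<forall>x\<in>pverts union. f x \<in> L x) \<longleftrightarrow>
      (\<forall>j\<in>I. \<forall>i\<in>J j. \<forall>v\<in>pverts (H j). f (j, i, v) \<in> L (j, i, v))"
    by force
  moreover have "(\<forall>(x, y)\<in>parcs union. f x \<noteq> f y) \<longleftrightarrow>
      (\<forall>j\<in>I. \<forall>i\<in>J j. \<forall>(u, v)\<in>parcs (H j). f (j, i, u) \<noteq> f (j, i, v))"
    by force
  moreover have "part f j i \<in> proper_list_colorings (H j) (\<lambda>v. L (j, i, v)) \<longleftrightarrow>
      (\<forall>v\<in>pverts (H j). f (j, i, v) \<in> L (j, i, v)) \<and>
      (\<forall>(u, v)\<in>parcs (H j). f (j, i, u) \<noteq> f (j, i, v))" if "j \<in> I" for j i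
    using in_pverts_of_arc[OF that]
    by (fastforce simp: proper_list_colorings_def part_def PiE_iff)
  ultimately show ?thesis
    by (simp add: ball_conj_distrib cong: ball_cong)
qed

text \<open>
  No edge joins two components and each component has its own lists, so representatives of arbitrary
  classes of list colorings, one for each component, glue to a coloring of the union.
\<close>

lemma component_classes_image:
  "component_classes ` proper_list_colorings union L =
    (\<Pi>\<^sub>E j\<in>I. transversals (J j) (\<lambda>i. list_coloring_classes (H j) (\<lambda>v. L (j, i, v))))"
  (is "?l = ?r")
proof (intro equalityI subsetI)
  fix F assume "F \<in> ?l"
  then obtain f where "f \<in> proper_list_colorings union L" and F: "F = component_classes f"
    by blast
  then have "coloring_class (H j) (part f j i) \<in> list_coloring_classes (H j) (\<lambda>v. L (j, i, v))"
    if "j \<in> I" "i \<in> J j" for j i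
    using that by (simp add: proper_list_colorings_union_iff list_coloring_classes_def)
  then show "F \<in> ?r"
    unfolding F component_classes_def by (auto intro!: image_mset_in_transversals)
next
  fix F assume F: "F \<in> ?r"
  have "\<exists>s. s \<in> Pi\<^sub>E (J j) (\<lambda>i. list_coloring_classes (H j) (\<lambda>v. L (j, i, v))) \<and>
      F j = image_mset s (mset_set (J j))" if "j \<in> I" for j
    using PiE_mem[OF F that] by (auto simp: transversals_def)
  then obtain s where s: "\<And>j i. j \<in> I \<Longrightarrow> i \<in> J j \<Longrightarrow> s j i \<in> list_coloring_classes (H j) (\<lambda>v. L (j, i, v))"
    and Fs: "\<And>j. j \<in> I \<Longrightarrow> F j = image_mset (s j) (mset_set (J j))"
    by (metis PiE_mem)
  have "\<exists>h. h \<in> proper_list_colorings (H j) (\<lambda>v. L (j, i, v)) \<and> s j i = coloring_class (H j) h"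
    if "j \<in> I" "i \<in> J j" for j i
    using s[OF that] by (auto simp: list_coloring_classes_def)
  then obtain h where h: "\<And>j i. j \<in> I \<Longrightarrow> i \<in> J j \<Longrightarrow> h j i \<in> proper_list_colorings (H j) (\<lambda>v. L (j, i, v))"
    and hs: "\<And>j i. j \<in> I \<Longrightarrow> i \<in> J j \<Longrightarrow> s j i = coloring_class (H j) (h j i)"
    by metis
  define f where "f = (\<lambda>(j, i, v)\<in>pverts union. h j i v)"
  have part: "part f j i = h j i" if "j \<in> I" "i \<in> J j" for j i
    using proper_list_colorings_extensional[OF h[OF that]] that
    by (auto simp: part_def f_def extensional_def fun_eq_iff)
  have "f \<in> proper_list_colorings union L"
    using h part by (auto simp: proper_list_colorings_union_iff f_def)
  moreover have "component_classes f = F"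
  proof (rule extensionalityI[of _ I])
    fix j assume j: "j \<in> I"
    have "image_mset (\<lambda>i. coloring_class (H j) (part f j i)) (mset_set (J j)) =
        image_mset (s j) (mset_set (J j))"
      using finite_J[OF j] hs[OF j] part[OF j] by (intro image_mset_cong) auto
    then show "component_classes f j = F j"
      using j Fs by (simp add: component_classes_def)
  qed (use F in \<open>auto simp: component_classes_def PiE_def\<close>)
  ultimately show "F \<in> ?l" by blast
qed

lemma num_unlabeled_list_colorings_union:
  "num_unlabeled_list_colorings union L =
    (\<Prod>j\<in>I. card (transversals (J j) (\<lambda>i. list_coloring_classes (H j) (\<lambda>v. L (j, i, v)))))"
proof -
  have "num_unlabeled_list_colorings union L =
      card (component_classes ` proper_list_colorings union L)"
    by (rule num_unlabeled_list_colorings_eq_card_image)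
      (simp add: equivalent_iff_same_component_classes)
  then show ?thesis
    by (simp add: component_classes_image card_PiE finite_I)
qed

theorem unlabeled_list_color_function_union:
  assumes eq: "\<And>j. j \<in> I \<Longrightarrow> unlabeled_list_color_function (H j) k = num_unlabeled_colorings (H j) k"
  shows "unlabeled_list_color_function union k = num_unlabeled_colorings union k"
proof (rule antisym)
  show "unlabeled_list_color_function union k \<le> num_unlabeled_colorings union k"
    unfolding num_unlabeled_colorings_eq_list
    by (rule unlabeled_list_color_function_le) (simp add: k_assignment_def)
next
  obtain L where L: "k_assignment union k L"
    and attained: "unlabeled_list_color_function union k = num_unlabeled_list_colorings union L"
    using unlabeled_list_color_function_attained by blast
  let ?B = "\<lambda>j. list_coloring_classes (H j) (\<lambda>_. {1..k})"
  let ?A = "\<lambda>j i. list_coloring_classes (H j) (\<lambda>v. L (j, i, v))"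
  have "card (transversals (J j) (\<lambda>_. ?B j)) \<le> card (transversals (J j) (?A j))" if j: "j \<in> I" for j
  proof (rule card_transversals_const_le)
    show "finite (J j)" "finite (?B j)"
      using j by (simp_all add: finite_J finite_list_coloring_classes finite_pverts)
    fix i assume i: "i \<in> J j"
    have "finite (?A j i)"
      using L j i by (intro finite_list_coloring_classes finite_pverts) (auto simp: k_assignment_def)
    \<comment> \<open>The lists of one copy form an assignment for \<open>H j\<close>, to which the hypothesis on \<open>H j\<close> applies.\<close>
    moreover have "k_assignment (H j) k (\<lambda>v. L (j, i, v))"
      using L j i by (auto simp: k_assignment_def)
    then have "card (?B j) \<le> card (?A j i)"
      using eq[OF j] unlabeled_list_color_function_le
      by (fastforce simp: card_list_coloring_classes num_unlabeled_colorings_eq_list)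
    ultimately show "finite (?A j i) \<and> card (?B j) \<le> card (?A j i)" by blast
  qed
  then show "num_unlabeled_colorings union k \<le> unlabeled_list_color_function union k"
    unfolding attained num_unlabeled_colorings_eq_list num_unlabeled_list_colorings_union
    by (intro prod_mono) auto
qed

end

theorem corollary1p7:
  fixes r N :: nat
    and G :: "nat \<Rightarrow> 'a pair_pre_digraph"
  assumes "r \<ge> 1"
    and "\<And>j. j \<in> {1..r} \<Longrightarrow> pair_graph (G j)"
    and "\<And>j. j \<in> {1..r} \<Longrightarrow> connected (with_proj (G j))"
    and "\<And>i j. i \<in> {1..r} \<Longrightarrow> j \<in> {1..r} \<Longrightarrow> i \<noteq> j \<Longrightarrow>
           \<not> digraph_iso (with_proj (G i)) (with_proj (G j))"
    and "N \<ge> 1"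
    and "\<And>j k. j \<in> {1..r} \<Longrightarrow> k \<ge> N \<Longrightarrow>
           unlabeled_list_color_function (G j) k = num_unlabeled_colorings (G j) k"
  shows "\<forall>m :: nat \<Rightarrow> nat. (\<forall>j\<in>{1..r}. m j \<ge> 1) \<longrightarrow>
           (\<forall>k\<ge>N.
              unlabeled_list_color_function (disjoint_union {1..r} (\<lambda>j. copies (m j) (G j))) k =
              num_unlabeled_colorings (disjoint_union {1..r} (\<lambda>j. copies (m j) (G j))) k)"
proof (intro allI impI)
  fix m :: "nat \<Rightarrow> nat" and k :: nat
  assume k: "k \<ge> N"
  interpret union_of_copies "{1..r}" "\<lambda>j. {1..m j}" G
  proof (rule union_of_copies.intro)
    fix i j \<phi> assume ij: "i \<in> {1..r}" "j \<in> {1..r}" and "graph_isomorphism \<phi> (G i) (G j)"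
    moreover have "pair_wf_digraph (G i)" "pair_wf_digraph (G j)"
      using assms(2)[OF ij(1)] assms(2)[OF ij(2)]
      by (simp_all add: pair_graph_def pair_digraph_def pair_fin_digraph_def)
    ultimately have "digraph_iso (with_proj (G i)) (with_proj (G j))"
      using digraph_iso_iff_graph_isomorphism by blast
    then show "i = j"
      using assms(4)[OF ij] by blast
  qed (simp_all only: assms(2,3) finite_atLeastAtMost)
  have "union = disjoint_union {1..r} (\<lambda>j. copies (m j) (G j))"
    by (simp only: union_def copies_def)
  then show "unlabeled_list_color_function (disjoint_union {1..r} (\<lambda>j. copies (m j) (G j))) k =
      num_unlabeled_colorings (disjoint_union {1..r} (\<lambda>j. copies (m j) (G j))) k"
    using unlabeled_list_color_function_union[of k] assms(6) k by simp
qed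

end
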